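(* Let $\Gamma$ be a finite simplicial graph with $n$ vertices, let $A(\Gamma)$ be the associated right-angled Artin group, and let $k\geq 1$ be an integer. Then $\Gamma$ is $k$-colorable if and only if there exist integers $m_1,\ldots,m_k\geq 0$ with $\sum_{i=1}^k m_i=n$ and a surjective group homomorphism $$A(\Gamma)\to \prod_{i=1}^k F_i,$$ where for each $1\leq i\leq k$ the group $F_i$ is a free group of rank $m_i$.
   Context: A finite simplicial graph $\Gamma$ has a finite vertex set $V(\Gamma)$ and an edge set $E(\Gamma)$ consisting of unordered pairs of distinct vertices (no loops, no multiple edges). The graph $\Gamma$ is $k$-colorable if there is a map $\kappa\colon V(\Gamma)\to\{1,\ldots,k\}$ (not required to be surjective) such that $\kappa(v)\neq\kappa(w)$ whenever $\{v,w\}\in E(\Gamma)$. The right-angled Artin group $A(\Gamma)$ is the group given by the presentation with generating set $V(\Gamma)$ and with one relation $[v,w]=1$ for each edge $\{v,w\}\in E(\Gamma)$, and no other relations. The free group of rank $0$ is the trivial group. *)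

theory Defs
  imports "HOL-Algebra.Generated_Groups" "HOL-Algebra.Product_Groups"
begin

subsection \<open>Finite simplicial graphs and colourings\<close>

definition finite_simplicial_graph :: "'a set \<Rightarrow> 'a set set \<Rightarrow> bool" where
  "finite_simplicial_graph V E \<longleftrightarrow> finite V \<and> E \<subseteq> {e. e \<subseteq> V \<and> card e = 2}"

definition colorable :: "nat \<Rightarrow> 'a set \<Rightarrow> 'a set set \<Rightarrow> bool" where
  "colorable k V E \<longleftrightarrow>
    (\<exists>\<kappa>. \<kappa> ` V \<subseteq> {1..k} \<and> (\<forall>v w. {v, w} \<in> E \<longrightarrow> \<kappa> v \<noteq> \<kappa> w))"


subsection \<open>Free groups\<close>

text \<open>A letter \<open>(x, True)\<close> stands for \<open>x\<close>, and \<open>(x, False)\<close> for its formal inverse.\<close>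

abbreviation words :: "'a set \<Rightarrow> ('a \<times> bool) list set" where
  "words X \<equiv> lists (X \<times> UNIV)"

inductive_set free_equiv :: "'a set \<Rightarrow> (('a \<times> bool) list \<times> ('a \<times> bool) list) set"
  for X :: "'a set" where
  refl: "u \<in> words X \<Longrightarrow> (u, u) \<in> free_equiv X"
| sym: "(u, v) \<in> free_equiv X \<Longrightarrow> (v, u) \<in> free_equiv X"
| trans: "(u, v) \<in> free_equiv X \<Longrightarrow> (v, w) \<in> free_equiv X \<Longrightarrow> (u, w) \<in> free_equiv X"
| cancel: "u \<in> words X \<Longrightarrow> v \<in> words X \<Longrightarrow> x \<in> X \<Longrightarrow>
    (u @ [(x, b), (x, \<not> b)] @ v, u @ v) \<in> free_equiv X"

text \<open>
  The elements are the classes of words; the product of the classes of \<open>u\<close> and \<open>v\<close> is the class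
  of \<open>u @ v\<close>. The rank of \<open>free_group X\<close> is the cardinality of \<open>X\<close>.
\<close>

definition free_group :: "'a set \<Rightarrow> ('a \<times> bool) list set monoid" where
  "free_group X =
    \<lparr>carrier = words X // free_equiv X,
     monoid.mult = (\<lambda>A B. \<Union>u\<in>A. \<Union>v\<in>B. free_equiv X `` {u @ v}),
     one = free_equiv X `` {[]}\<rparr>"

definition free_gen :: "'a set \<Rightarrow> 'a \<Rightarrow> ('a \<times> bool) list set" where
  "free_gen X x = free_equiv X `` {[(x, True)]}"

lemma free_equiv_words:
  assumes "(u, v) \<in> free_equiv X"
  shows "u \<in> words X" "v \<in> words X"
  using assms by (induction rule: free_equiv.induct) auto

lemma equiv_free_equiv: "equiv (words X) (free_equiv X)"
proof (rule equivI)
  show "free_equiv X \<subseteq> words X \<times> words X"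
    using free_equiv_words by fast
qed (auto intro!: refl_onI symI transI intro: free_equiv.intros del: in_listsD in_listsI)

lemma free_equiv_append_left:
  assumes "(u, v) \<in> free_equiv X" "w \<in> words X"
  shows "(w @ u, w @ v) \<in> free_equiv X"
  using assms
proof (induction rule: free_equiv.induct)
  case (cancel u v x b)
  then have "((w @ u) @ [(x, b), (x, \<not> b)] @ v, (w @ u) @ v) \<in> free_equiv X"
    by (intro free_equiv.cancel) auto
  then show ?case by simp
qed (auto intro: free_equiv.intros del: in_listsD in_listsI)

lemma free_equiv_append_right:
  assumes "(u, v) \<in> free_equiv X" "w \<in> words X"
  shows "(u @ w, v @ w) \<in> free_equiv X"
  using assms
proof (induction rule: free_equiv.induct)
  case (cancel u v x b)
  then have "(u @ [(x, b), (x, \<not> b)] @ (v @ w), u @ (v @ w)) \<in> free_equiv X"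
    by (intro free_equiv.cancel) auto
  then show ?case by simp
qed (auto intro: free_equiv.intros del: in_listsD in_listsI)

lemma free_equiv_append:
  assumes "(u, u') \<in> free_equiv X" "(v, v') \<in> free_equiv X"
  shows "(u @ v, u' @ v') \<in> free_equiv X"
  using assms free_equiv_append_left free_equiv_append_right free_equiv_words free_equiv.trans
  by metis

lemma mult_free_group:
  assumes "u \<in> words X" "v \<in> words X"
  shows "free_equiv X `` {u} \<otimes>\<^bsub>free_group X\<^esub> free_equiv X `` {v} = free_equiv X `` {u @ v}"
proof -
  have "(\<lambda>u v. free_equiv X `` {u @ v}) respects2 free_equiv X"
    by (rule congruent2I') (metis equiv_class_eq equiv_free_equiv free_equiv_append)
  then show ?thesis
    using UN_equiv_class2[OF equiv_free_equiv equiv_free_equiv, of X X] assms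
    by (simp add: free_group_def)
qed

definition inv_word :: "('a \<times> bool) list \<Rightarrow> ('a \<times> bool) list" where
  "inv_word u = rev (map (\<lambda>(x, b). (x, \<not> b)) u)"

lemma inv_word_closed: "u \<in> words X \<Longrightarrow> inv_word u \<in> words X"
  by (auto simp: inv_word_def)

lemma free_equiv_inv_word:
  assumes "u \<in> words X"
  shows "(inv_word u @ u, []) \<in> free_equiv X"
  using assms
proof (induction rule: lists.induct)
  case Nil
  then show ?case by (simp add: inv_word_def free_equiv.refl)
next
  case (Cons a u)
  obtain x b where a: "a = (x, b)" by force
  have "u \<in> words X" "x \<in> X"
    using Cons.hyps a by auto
  then have "(inv_word u @ [(x, \<not> b), (x, \<not> \<not> b)] @ u, inv_word u @ u) \<in> free_equiv X"
    by (simp only: free_equiv.cancel inv_word_closed)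
  moreover have "(inv_word u @ u, []) \<in> free_equiv X"
    by (rule Cons.IH)
  ultimately show ?case
    using free_equiv.trans by (fastforce simp: a inv_word_def)
qed

lemma group_free_group: "group (free_group X)"
proof (rule groupI)
  have carr: "\<exists>u\<in>words X. A = free_equiv X `` {u}" if "A \<in> carrier (free_group X)" for A
    using that by (auto simp: free_group_def elim: quotientE)
  have carrI: "free_equiv X `` {u} \<in> carrier (free_group X)" if "u \<in> words X" for u
    using that by (simp add: free_group_def quotientI)
  have one: "\<one>\<^bsub>free_group X\<^esub> = free_equiv X `` {[]}"
    by (simp add: free_group_def)
  show "\<one>\<^bsub>free_group X\<^esub> \<in> carrier (free_group X)"
    by (simp add: one carrI)
  show "A \<otimes>\<^bsub>free_group X\<^esub> B \<in> carrier (free_group X)"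
    if "A \<in> carrier (free_group X)" "B \<in> carrier (free_group X)" for A B
    using carr[OF that(1)] carr[OF that(2)] by (auto simp: mult_free_group intro!: carrI del: in_listsD in_listsI)
  show "A \<otimes>\<^bsub>free_group X\<^esub> B \<otimes>\<^bsub>free_group X\<^esub> C = A \<otimes>\<^bsub>free_group X\<^esub> (B \<otimes>\<^bsub>free_group X\<^esub> C)"
    if "A \<in> carrier (free_group X)" "B \<in> carrier (free_group X)" "C \<in> carrier (free_group X)"
    for A B C
    using carr[OF that(1)] carr[OF that(2)] carr[OF that(3)]
    by (auto simp: mult_free_group del: in_listsD in_listsI)
  show "\<one>\<^bsub>free_group X\<^esub> \<otimes>\<^bsub>free_group X\<^esub> A = A" if "A \<in> carrier (free_group X)" for A
    using carr[OF that] by (auto simp: one mult_free_group del: in_listsD in_listsI)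
  show "\<exists>B\<in>carrier (free_group X). B \<otimes>\<^bsub>free_group X\<^esub> A = \<one>\<^bsub>free_group X\<^esub>"
    if "A \<in> carrier (free_group X)" for A
  proof -
    from carr[OF that] obtain u where u: "u \<in> words X" "A = free_equiv X `` {u}"
      by blast
    have "free_equiv X `` {inv_word u @ u} = free_equiv X `` {[]}"
      using u free_equiv_inv_word equiv_class_eq equiv_free_equiv by metis
    then show ?thesis
      using u by (intro bexI[of _ "free_equiv X `` {inv_word u}"])
        (simp_all add: mult_free_group inv_word_closed one carrI)
  qed
qed

lemma free_gen_closed: "x \<in> X \<Longrightarrow> free_gen X x \<in> carrier (free_group X)"
  by (auto simp: free_gen_def free_group_def intro!: quotientI)


subsection \<open>Presentations and right-angled Artin groups\<close>

definition normal_closure :: "('g, 'b) monoid_scheme \<Rightarrow> 'g set \<Rightarrow> 'g set" where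
  "normal_closure G S = generate G (\<Union>g\<in>carrier G. \<Union>s\<in>S. {g \<otimes>\<^bsub>G\<^esub> s \<otimes>\<^bsub>G\<^esub> inv\<^bsub>G\<^esub> g})"

lemma (in group) normal_normal_closure:
  assumes "S \<subseteq> carrier G"
  shows "normal_closure G S \<lhd> G"
  unfolding normal_closure_def
proof (rule normal_generateI)
  show "(\<Union>g\<in>carrier G. \<Union>s\<in>S. {g \<otimes> s \<otimes> inv g}) \<subseteq> carrier G"
    using assms by auto
  fix h g
  assume "h \<in> (\<Union>g\<in>carrier G. \<Union>s\<in>S. {g \<otimes> s \<otimes> inv g})" and g: "g \<in> carrier G"
  then obtain f s where fs: "f \<in> carrier G" "s \<in> S" "h = f \<otimes> s \<otimes> inv f"
    by auto
  with assms g have "g \<otimes> h \<otimes> inv g = (g \<otimes> f) \<otimes> s \<otimes> inv (g \<otimes> f)"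
    by (auto simp: inv_mult_group m_assoc subset_iff)
  with fs g show "g \<otimes> h \<otimes> inv g \<in> (\<Union>g\<in>carrier G. \<Union>s\<in>S. {g \<otimes> s \<otimes> inv g})"
    by blast
qed

definition presented_group ::
  "'a set \<Rightarrow> ('a \<times> bool) list set set \<Rightarrow> ('a \<times> bool) list set set monoid" where
  "presented_group X R = free_group X Mod normal_closure (free_group X) R"

lemma group_presented_group:
  "R \<subseteq> carrier (free_group X) \<Longrightarrow> group (presented_group X R)"
  unfolding presented_group_def
  by (intro normal.factorgroup_is_group group.normal_normal_closure group_free_group)

definition commutator :: "('g, 'b) monoid_scheme \<Rightarrow> 'g \<Rightarrow> 'g \<Rightarrow> 'g" where
  "commutator G x y = x \<otimes>\<^bsub>G\<^esub> y \<otimes>\<^bsub>G\<^esub> inv\<^bsub>G\<^esub> x \<otimes>\<^bsub>G\<^esub> inv\<^bsub>G\<^esub> y"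

text \<open>
  An edge \<open>{v, w}\<close> is unordered, so it contributes both \<open>[v, w]\<close> and \<open>[w, v]\<close>. These are inverse
  to each other, so the normal closure is the same as for a single choice per edge.
\<close>

definition raag :: "'a set \<Rightarrow> 'a set set \<Rightarrow> ('a \<times> bool) list set set monoid" where
  "raag V E = presented_group V
    {commutator (free_group V) (free_gen V v) (free_gen V w) | v w. {v, w} \<in> E}"

lemma group_raag:
  assumes "finite_simplicial_graph V E"
  shows "group (raag V E)"
  unfolding raag_def
proof (rule group_presented_group)
  interpret F: group "free_group V" by (rule group_free_group)
  have "v \<in> V \<and> w \<in> V" if "{v, w} \<in> E" for v w
    using assms that by (auto simp: finite_simplicial_graph_def)
  then show "{commutator (free_group V) (free_gen V v) (free_gen V w) | v w. {v, w} \<in> E}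
      \<subseteq> carrier (free_group V)"
    by (auto simp: commutator_def free_gen_closed)
qed

end

theory Submission
  imports Defs "Jordan_Normal_Form.Determinant"
begin

text \<open>
  If \<open>\<kappa>\<close> is a colouring and \<open>F\<^sub>i\<close> is free on the vertices of colour \<open>i\<close>, send each vertex
  \<open>v\<close> to the free generator \<open>v\<close> of the factor \<open>F\<^sub>i\<close> with \<open>i = \<kappa> v\<close>. Adjacent vertices go to
  different factors, so their images commute and this extends to the right-angled Artin group;
  the image contains every factor, hence everything (\<open>colorable_imp_epi\<close>).

  Conversely, let \<open>h\<close> be an epimorphism onto the product. For every vertex \<open>v\<close> and every free
  generator \<open>j\<close> of every factor \<open>F\<^sub>i\<close>, let \<open>M v (i, j)\<close> be the exponent sum of \<open>j\<close> in the \<open>i\<close>-th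
  coordinate of \<open>h v\<close>. This is the matrix of the map induced on abelianizations. It is
  square because the ranks add up to the number of vertices, and it has a left inverse over
  the integers because \<open>h\<close> is surjective, so its determinant is nonzero. Its columns come in
  blocks, one for each factor. Splitting every row into its parts in the different blocks and
  expanding by multilinearity writes the determinant as a sum over all ways \<open>\<kappa>\<close> of choosing one
  block for each row; some \<open>\<kappa>\<close> contributes a nonzero term. For this \<open>\<kappa>\<close>, two rows that were given
  the same block cannot be proportional in it (\<open>ex_block_assignment\<close>).

  This \<open>\<kappa>\<close> is a colouring: the images of adjacent vertices commute in every factor, and
  commuting elements of a free group have proportional exponent vectors. The reason for the latter
  is that a pair of homomorphisms \<open>\<alpha>\<close>, \<open>\<beta>\<close> from a free group to the
  integers lifts to the integral Heisenberg group, where commuting of \<open>a\<close> and \<open>b\<close> says exactly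
  that \<open>\<alpha> a * \<beta> b = \<beta> a * \<alpha> b\<close> (\<open>free_group_commuting_minor_zero\<close>).
\<close>

section \<open>Maps out of free groups\<close>

definition word_eval :: "('g, 'b) monoid_scheme \<Rightarrow> ('a \<Rightarrow> 'g) \<Rightarrow> ('a \<times> bool) list \<Rightarrow> 'g" where
  "word_eval G f u =
    foldr (\<lambda>(x, b) g. (if b then f x else inv\<^bsub>G\<^esub> f x) \<otimes>\<^bsub>G\<^esub> g) u \<one>\<^bsub>G\<^esub>"

lemma word_eval_Nil [simp]: "word_eval G f [] = \<one>\<^bsub>G\<^esub>"
  by (simp add: word_eval_def)

lemma word_eval_Cons [simp]:
  "word_eval G f ((x, b) # u) = (if b then f x else inv\<^bsub>G\<^esub> f x) \<otimes>\<^bsub>G\<^esub> word_eval G f u"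
  by (simp add: word_eval_def)

context group
begin

lemma word_eval_in_subgroup:
  assumes "subgroup H G" "f \<in> X \<rightarrow> H" "u \<in> words X"
  shows "word_eval G f u \<in> H"
  using assms(3)
proof (induction rule: lists.induct)
  case (Cons a u)
  then show ?case
    using assms(1,2)
    by (cases a) (auto simp: subgroup.m_closed subgroup.m_inv_closed Pi_iff)
qed (use assms(1) in \<open>simp add: subgroup.one_closed\<close>)

lemmas word_eval_closed = word_eval_in_subgroup[OF subgroup_self]

lemma word_eval_append:
  assumes f: "f \<in> X \<rightarrow> carrier G" and "u \<in> words X" and v: "v \<in> words X"
  shows "word_eval G f (u @ v) = word_eval G f u \<otimes> word_eval G f v"
  using assms(2)
proof (induction rule: lists.induct)
  case Nil
  then show ?case using word_eval_closed[OF f v] by simp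
next
  case (Cons a u)
  then show ?case
    using word_eval_closed[OF f v] word_eval_closed[OF f Cons.hyps(2)] f
    by (cases a) (auto simp: m_assoc Pi_iff)
qed

lemma word_eval_free_equiv:
  assumes "(u, v) \<in> free_equiv X" and f: "f \<in> X \<rightarrow> carrier G"
  shows "word_eval G f u = word_eval G f v"
  using assms(1)
proof (induction rule: free_equiv.induct)
  case (cancel u v x b)
  have x: "f x \<in> carrier G" using f cancel.hyps(3) by auto
  have v: "word_eval G f v \<in> carrier G" by (rule word_eval_closed[OF f cancel.hyps(2)])
  have "word_eval G f ([(x, b), (x, \<not> b)] @ v) = word_eval G f v"
    using x v by (cases b) (simp_all add: m_assoc[symmetric])
  moreover have "[(x, b), (x, \<not> b)] @ v \<in> words X"
    using cancel.hyps by auto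
  ultimately show ?case
    by (simp only: word_eval_append[OF f cancel.hyps(1)] cancel.hyps(2))
qed simp_all

lemma hom_word_eval:
  assumes H: "group H" and h: "h \<in> hom G H" and f: "f \<in> X \<rightarrow> carrier G" and "u \<in> words X"
  shows "h (word_eval G f u) = word_eval H (h \<circ> f) u"
  using assms(4)
proof (induction rule: lists.induct)
  interpret group_hom G H h
    using H h by (simp add: group_hom_def group_hom_axioms_def is_group)
  case Nil
  then show ?case by simp
next
  case (Cons a u)
  have closed: "word_eval G f u \<in> carrier G" by (rule word_eval_closed[OF f Cons.hyps(2)])
  interpret group_hom G H h
    using H h by (simp add: group_hom_def group_hom_axioms_def is_group)
  show ?case
    using Cons f closed by (cases a) (auto simp: Pi_iff)
qed

end

lemma free_gen_in_carrier: "free_gen X \<in> X \<rightarrow> carrier (free_group X)"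
  by (simp add: free_gen_closed)

text \<open>
  The class of a word is the value of that word at the free generators. Together with
  \<open>hom_word_eval\<close> it turns statements about homomorphisms on a free group into inductions over
  words.
\<close>

lemma word_eval_free_gen:
  assumes "u \<in> words X"
  shows "word_eval (free_group X) (free_gen X) u = free_equiv X `` {u}"
  using assms
proof (induction rule: lists.induct)
  case Nil
  then show ?case by (simp add: free_group_def)
next
  interpret F: group "free_group X" by (rule group_free_group)
  case (Cons a u)
  obtain x b where a: "a = (x, b)" by force
  have x: "x \<in> X" using Cons.hyps a by auto
  have "inv\<^bsub>free_group X\<^esub> free_gen X x = free_equiv X `` {[(x, False)]}"
  proof (rule F.inv_equality)
    have "([(x, False), (x, True)], []) \<in> free_equiv X"
      using free_equiv.cancel[of "[]" X "[]" x False] x by simp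
    then have "free_equiv X `` {[(x, False), (x, True)]} = free_equiv X `` {[]}"
      by (rule equiv_class_eq[OF equiv_free_equiv])
    then show "free_equiv X `` {[(x, False)]} \<otimes>\<^bsub>free_group X\<^esub> free_gen X x = \<one>\<^bsub>free_group X\<^esub>"
      using x mult_free_group[of "[(x, False)]" X "[(x, True)]"]
      by (simp add: free_gen_def free_group_def)
  next
    show "free_equiv X `` {[(x, False)]} \<in> carrier (free_group X)"
      using x by (auto simp: free_group_def intro!: quotientI)
  qed (simp add: x free_gen_closed)
  then have "(if b then free_gen X x else inv\<^bsub>free_group X\<^esub> free_gen X x) = free_equiv X `` {[a]}"
    by (simp add: a free_gen_def)
  then show ?case
    using Cons.IH Cons.hyps x mult_free_group[of "[a]" X u] by (simp add: a)
qed

lemma free_group_elem: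
  assumes "A \<in> carrier (free_group X)"
  obtains u where "u \<in> words X" "A = word_eval (free_group X) (free_gen X) u"
proof -
  obtain u where u: "u \<in> words X" "A = free_equiv X `` {u}"
    using assms by (auto simp: free_group_def quotient_def)
  then show thesis
    using that[OF u(1)] word_eval_free_gen[OF u(1)] by simp
qed

text \<open>
  The universal property: evaluating words does not distinguish equivalent words
  (\<open>word_eval_free_equiv\<close>), so any representative of a class may be evaluated.
\<close>

lemma (in group) free_group_lift:
  assumes f: "f \<in> X \<rightarrow> carrier G"
  obtains h where "h \<in> hom (free_group X) G" "\<And>x. x \<in> X \<Longrightarrow> h (free_gen X x) = f x"
proof -
  define h where "h A = word_eval G f (SOME u. u \<in> A)" for A
  have h: "h (free_equiv X `` {u}) = word_eval G f u" if "u \<in> words X" for u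
  proof -
    have "u \<in> free_equiv X `` {u}"
      using that by (simp add: free_equiv.refl)
    then have "(u, SOME v. v \<in> free_equiv X `` {u}) \<in> free_equiv X"
      by (metis Image_singleton_iff someI)
    then show ?thesis
      unfolding h_def using word_eval_free_equiv[OF _ f] by metis
  qed
  show thesis
  proof
    show "h \<in> hom (free_group X) G"
    proof (rule homI)
      fix A assume "A \<in> carrier (free_group X)"
      then obtain u where u: "u \<in> words X" "A = free_equiv X `` {u}"
        by (metis free_group_elem word_eval_free_gen)
      then show "h A \<in> carrier G"
        using h word_eval_closed[OF f] by simp
      fix B assume "B \<in> carrier (free_group X)"
      then obtain v where v: "v \<in> words X" "B = free_equiv X `` {v}"
        by (metis free_group_elem word_eval_free_gen)
      have "u @ v \<in> words X" using u v by simp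
      then show "h (A \<otimes>\<^bsub>free_group X\<^esub> B) = h A \<otimes> h B"
        using u v by (simp only: mult_free_group h word_eval_append[OF f])
    qed
    show "h (free_gen X x) = f x" if "x \<in> X" for x
    proof -
      have "f x \<in> carrier G" "[(x, True)] \<in> words X" using that f by auto
      then show ?thesis using h[of "[(x, True)]"] by (simp add: free_gen_def)
    qed
  qed
qed

lemma free_group_hom_eqI:
  assumes G: "group G" and h: "h \<in> hom (free_group X) G" "h' \<in> hom (free_group X) G"
    and eq: "\<And>x. x \<in> X \<Longrightarrow> h (free_gen X x) = h' (free_gen X x)"
    and A: "A \<in> carrier (free_group X)"
  shows "h A = h' A"
proof -
  interpret F: group "free_group X" by (rule group_free_group)
  obtain u where u: "u \<in> words X" "A = word_eval (free_group X) (free_gen X) u"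
    using A by (rule free_group_elem)
  have "word_eval G (h \<circ> free_gen X) u = word_eval G (h' \<circ> free_gen X) u"
    using u(1) by (induction rule: lists.induct) (auto simp: eq)
  then show ?thesis
    using F.hom_word_eval[OF G _ free_gen_in_carrier u(1)] h u(2) by metis
qed

section \<open>Right-angled Artin groups\<close>

definition raag_relators :: "'a set \<Rightarrow> 'a set set \<Rightarrow> ('a \<times> bool) list set set" where
  "raag_relators V E =
    {commutator (free_group V) (free_gen V v) (free_gen V w) | v w. {v, w} \<in> E}"

definition raag_gen :: "'a set \<Rightarrow> 'a set set \<Rightarrow> 'a \<Rightarrow> ('a \<times> bool) list set set" where
  "raag_gen V E v =
    normal_closure (free_group V) (raag_relators V E) #>\<^bsub>free_group V\<^esub> free_gen V v"

lemma raag_eq: "raag V E = free_group V Mod normal_closure (free_group V) (raag_relators V E)"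
  by (simp add: raag_def presented_group_def raag_relators_def)

lemma edge_vertices:
  assumes "finite_simplicial_graph V E" "{v, w} \<in> E"
  shows "v \<in> V" "w \<in> V" "v \<noteq> w"
  using assms by (auto simp: finite_simplicial_graph_def)

lemma raag_relators_closed:
  assumes "finite_simplicial_graph V E"
  shows "raag_relators V E \<subseteq> carrier (free_group V)"
proof -
  interpret F: group "free_group V" by (rule group_free_group)
  show ?thesis
    using edge_vertices[OF assms]
    by (auto simp: raag_relators_def commutator_def free_gen_closed)
qed

lemma normal_raag_relators:
  assumes "finite_simplicial_graph V E"
  shows "normal_closure (free_group V) (raag_relators V E) \<lhd> free_group V"
  by (intro group.normal_normal_closure group_free_group raag_relators_closed assms)

lemma (in group) subset_normal_closure:
  assumes "S \<subseteq> carrier G"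
  shows "S \<subseteq> normal_closure G S"
proof
  fix s assume s: "s \<in> S"
  then have "s = \<one> \<otimes> s \<otimes> inv \<one>" using assms by auto
  then have "s \<in> (\<Union>g\<in>carrier G. \<Union>s\<in>S. {g \<otimes> s \<otimes> inv g})" using s by blast
  then show "s \<in> normal_closure G S"
    unfolding normal_closure_def by (rule generate.incl)
qed

lemma (in group) normal_closure_subset:
  assumes "N \<lhd> G" "S \<subseteq> N"
  shows "normal_closure G S \<subseteq> N"
  unfolding normal_closure_def
proof (rule generate_subgroup_incl)
  show "(\<Union>g\<in>carrier G. \<Union>s\<in>S. {g \<otimes> s \<otimes> inv g}) \<subseteq> N"
    using assms by (auto simp: normal_inv_iff)
qed (use assms in \<open>simp add: normal_imp_subgroup\<close>)

lemma (in group) commutator_eq_one_iff: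
  assumes "x \<in> carrier G" "y \<in> carrier G"
  shows "commutator G x y = \<one> \<longleftrightarrow> x \<otimes> y = y \<otimes> x"
proof -
  have "commutator G x y = (x \<otimes> y) \<otimes> inv (y \<otimes> x)"
    using assms by (simp add: commutator_def inv_mult_group m_assoc)
  then show ?thesis
    using assms by (metis inv_closed inv_inv inv_equality m_closed r_inv)
qed

lemma hom_commutator:
  assumes "group G" "group H" "h \<in> hom G H" "x \<in> carrier G" "y \<in> carrier G"
  shows "h (commutator G x y) = commutator H (h x) (h y)"
proof -
  interpret group_hom G H h
    using assms by (simp add: group_hom_def group_hom_axioms_def)
  show ?thesis using assms by (simp add: commutator_def)
qed

context
  fixes V :: "'a set" and E :: "'a set set"
  assumes graph: "finite_simplicial_graph V E"
begin

lemma raag_proj_hom: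
  "(\<lambda>A. normal_closure (free_group V) (raag_relators V E) #>\<^bsub>free_group V\<^esub> A)
    \<in> hom (free_group V) (raag V E)"
  unfolding raag_eq by (rule normal.r_coset_hom_Mod[OF normal_raag_relators[OF graph]])

lemma raag_gen_in_carrier: "raag_gen V E \<in> V \<rightarrow> carrier (raag V E)"
  using raag_proj_hom by (auto simp: raag_gen_def hom_def free_gen_closed)

text \<open>
  Values of words at the generators exhaust the group, since this holds in the free group and
  the quotient map is a homomorphism onto.
\<close>

lemma raag_elem:
  assumes "y \<in> carrier (raag V E)"
  obtains u where "u \<in> words V" "y = word_eval (raag V E) (raag_gen V E) u"
proof -
  interpret F: group "free_group V" by (rule group_free_group)
  let ?p = "\<lambda>A. normal_closure (free_group V) (raag_relators V E) #>\<^bsub>free_group V\<^esub> A"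
  obtain A where A: "A \<in> carrier (free_group V)" "y = ?p A"
    using assms by (auto simp: raag_eq carrier_FactGroup)
  then obtain u where u: "u \<in> words V" "A = word_eval (free_group V) (free_gen V) u"
    by (metis free_group_elem)
  have "?p A = word_eval (raag V E) (?p \<circ> free_gen V) u"
    unfolding u(2)
    by (rule F.hom_word_eval[OF group_raag[OF graph] raag_proj_hom free_gen_in_carrier u(1)])
  then show thesis
    using that[OF u(1)] A(2) by (simp add: raag_gen_def[abs_def] comp_def)
qed

lemma raag_gen_commute:
  assumes e: "{v, w} \<in> E"
  shows "raag_gen V E v \<otimes>\<^bsub>raag V E\<^esub> raag_gen V E w = raag_gen V E w \<otimes>\<^bsub>raag V E\<^esub> raag_gen V E v"
proof -
  interpret F: group "free_group V" by (rule group_free_group)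
  interpret A: group "raag V E" by (rule group_raag[OF graph])
  let ?N = "normal_closure (free_group V) (raag_relators V E)"
  let ?c = "commutator (free_group V) (free_gen V v) (free_gen V w)"
  have vw: "v \<in> V" "w \<in> V" using edge_vertices[OF graph e] by auto
  have "?c \<in> raag_relators V E" using e by (auto simp: raag_relators_def)
  then have "?c \<in> ?N"
    using F.subset_normal_closure[OF raag_relators_closed[OF graph]] by blast
  then have "?N #>\<^bsub>free_group V\<^esub> ?c = \<one>\<^bsub>raag V E\<^esub>"
    using normal_imp_subgroup[OF normal_raag_relators[OF graph]]
    by (simp add: raag_eq F.coset_join2 subgroup.mem_carrier)
  then have "commutator (raag V E) (raag_gen V E v) (raag_gen V E w) = \<one>\<^bsub>raag V E\<^esub>"
    using hom_commutator[OF F.is_group A.is_group raag_proj_hom] vw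
    by (simp add: raag_gen_def free_gen_closed)
  then show ?thesis
    using A.commutator_eq_one_iff raag_gen_in_carrier vw by (simp add: Pi_iff)
qed

text \<open>
  The universal property of the presentation: the images of the relators under the lift to the
  free group are commutators of commuting elements, so its kernel contains their normal
  closure.
\<close>

lemma raag_lift:
  assumes G: "group G" and f: "f \<in> V \<rightarrow> carrier G"
    and comm: "\<And>v w. {v, w} \<in> E \<Longrightarrow> f v \<otimes>\<^bsub>G\<^esub> f w = f w \<otimes>\<^bsub>G\<^esub> f v"
  obtains h where "h \<in> hom (raag V E) G" "\<And>v. v \<in> V \<Longrightarrow> h (raag_gen V E v) = f v"
proof -
  interpret F: group "free_group V" by (rule group_free_group)
  interpret G: group G by (rule G)
  obtain g where g: "g \<in> hom (free_group V) G" "\<And>x. x \<in> V \<Longrightarrow> g (free_gen V x) = f x"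
    using G.free_group_lift[OF f] by blast
  interpret g: group_hom "free_group V" G g
    using g by unfold_locales
  have "g (commutator (free_group V) (free_gen V v) (free_gen V w)) = \<one>\<^bsub>G\<^esub>"
    if e: "{v, w} \<in> E" for v w
    using edge_vertices[OF graph e] hom_commutator[OF F.is_group G g(1)] g(2)
      G.commutator_eq_one_iff comm[OF e] f
    by (simp add: free_gen_closed Pi_iff)
  then have "raag_relators V E \<subseteq> kernel (free_group V) G g"
    using raag_relators_closed[OF graph] unfolding kernel_def raag_relators_def by blast
  then have "normal_closure (free_group V) (raag_relators V E) \<subseteq> kernel (free_group V) G g"
    by (rule F.normal_closure_subset[OF g.normal_kernel])
  then obtain h where "h \<in> hom (raag V E) G"
    "\<And>A. A \<in> carrier (free_group V) \<Longrightarrow>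
      h (normal_closure (free_group V) (raag_relators V E) #>\<^bsub>free_group V\<^esub> A) = g A"
    using g.FactGroup_universal_kernel[OF normal_raag_relators[OF graph]] unfolding raag_eq by metis
  then show thesis
    using that g(2) by (simp add: raag_gen_def free_gen_closed)
qed

end

section \<open>Commuting elements of a free group\<close>

text \<open>
  The triple \<open>(a, b, c)\<close> is the upper unitriangular 3 by 3 matrix with \<open>a\<close>, \<open>b\<close> next to the
  diagonal and \<open>c\<close> in the corner.
\<close>

definition heisenberg :: "(int \<times> int \<times> int) monoid" where
  "heisenberg = \<lparr>carrier = UNIV,
     monoid.mult = (\<lambda>(a, b, c) (a', b', c'). (a + a', b + b', c + c' + a * b')),
     one = (0, 0, 0)\<rparr>"

lemma group_heisenberg: "group heisenberg"
proof (rule groupI)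
  fix x assume "x \<in> carrier heisenberg"
  obtain a b c where x: "x = (a, b, c)" by (cases x)
  show "\<exists>y\<in>carrier heisenberg. y \<otimes>\<^bsub>heisenberg\<^esub> x = \<one>\<^bsub>heisenberg\<^esub>"
    by (rule bexI[of _ "(- a, - b, a * b - c)"]) (auto simp: heisenberg_def x)
qed (auto simp: heisenberg_def algebra_simps)

text \<open>
  Lift \<open>\<alpha>\<close> and \<open>\<beta>\<close> to the Heisenberg group by \<open>x \<mapsto> (\<alpha> x, \<beta> x, 0)\<close> on generators. The first two
  coordinates of this lift are homomorphisms and hence agree with \<open>\<alpha>\<close> and \<open>\<beta>\<close> everywhere. The
  corner entries of the two products of \<open>(a, b, c)\<close> and \<open>(a', b', c')\<close> differ by
  \<open>a * b' - a' * b\<close>.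
\<close>

lemma free_group_commuting_minor_zero:
  assumes a: "a \<in> carrier (free_group X)" and b: "b \<in> carrier (free_group X)"
    and ab: "a \<otimes>\<^bsub>free_group X\<^esub> b = b \<otimes>\<^bsub>free_group X\<^esub> a"
    and \<alpha>: "\<alpha> \<in> hom (free_group X) integer_group"
    and \<beta>: "\<beta> \<in> hom (free_group X) integer_group"
  shows "\<alpha> a * \<beta> b = \<beta> a * \<alpha> b"
proof -
  interpret H: group heisenberg by (rule group_heisenberg)
  obtain h where h: "h \<in> hom (free_group X) heisenberg"
    "\<And>x. x \<in> X \<Longrightarrow> h (free_gen X x) = (\<alpha> (free_gen X x), \<beta> (free_gen X x), 0)"
    using H.free_group_lift[of "\<lambda>x. (\<alpha> (free_gen X x), \<beta> (free_gen X x), 0)" X]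
    by (auto simp: heisenberg_def)
  have fst: "fst (h c) = \<alpha> c" and snd: "fst (snd (h c)) = \<beta> c" if "c \<in> carrier (free_group X)" for c
  proof -
    have "fst \<in> hom heisenberg integer_group" "fst \<circ> snd \<in> hom heisenberg integer_group"
      by (auto simp: hom_def heisenberg_def)
    from this[THEN hom_compose[OF h(1)]]
    have "fst \<circ> h \<in> hom (free_group X) integer_group"
      "(fst \<circ> snd) \<circ> h \<in> hom (free_group X) integer_group" .
    from this[THEN free_group_hom_eqI[OF group_integer_group], OF \<alpha> _ that]
      this[THEN free_group_hom_eqI[OF group_integer_group], OF \<beta> _ that]
    show "fst (h c) = \<alpha> c" "fst (snd (h c)) = \<beta> c"
      by (simp_all add: h(2))
  qed
  have "h a \<otimes>\<^bsub>heisenberg\<^esub> h b = h b \<otimes>\<^bsub>heisenberg\<^esub> h a"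
    using hom_mult[OF h(1)] a b ab by metis
  then have "fst (h a) * fst (snd (h b)) = fst (h b) * fst (snd (h a))"
    by (simp add: heisenberg_def split: prod.splits)
  then show ?thesis
    using a b by (simp add: fst snd)
qed

section \<open>Splitting the rows of an invertible matrix among blocks of columns\<close>

text \<open>
  Exchanging the columns that a permutation assigns to the two rows \<open>v\<close> and \<open>w\<close> keeps the
  product of entries, by the vanishing of the minor, and changes the sign. So the Leibniz sum
  is its own negative.
\<close>

lemma det_zero_if_minors_zero:
  fixes A :: "int mat"
  assumes A: "A \<in> carrier_mat n n" and vw: "v < n" "w < n" "v \<noteq> w"
    and minor: "\<And>c d. c < n \<Longrightarrow> d < n \<Longrightarrow> A $$ (v, c) * A $$ (w, d) = A $$ (v, d) * A $$ (w, c)"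
  shows "det A = 0"
proof -
  let ?P = "{p. p permutes {0..<n}}"
  let ?\<tau> = "Transposition.transpose v w"
  let ?t = "\<lambda>p. signof p * (\<Prod>i = 0..<n. A $$ (i, p i)) :: int"
  have \<tau>: "?\<tau> permutes {0..<n}" using vw by (intro permutes_swap_id) auto
  have "?t (p \<circ> ?\<tau>) = - ?t p" if p: "p \<in> ?P" for p
  proof -
    have "signof (p \<circ> ?\<tau>) = (- signof p :: int)"
      using p \<tau> vw by (simp add: sign_compose permutation_permutes[THEN iffD2, OF exI[of _ "{0..<n}"]]
          sign_swap_id)
    moreover have "(\<Prod>i = 0..<n. A $$ (i, (p \<circ> ?\<tau>) i)) = (\<Prod>i = 0..<n. A $$ (i, p i))"
    proof -
      have split: "prod g {0..<n} = g v * g w * prod g ({0..<n} - {v, w})" for g :: "nat \<Rightarrow> int"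
        using vw by (subst prod.subset_diff[of "{v, w}"]) (auto simp: mult.commute)
      have "p v < n" "p w < n" using p vw permutes_in_image[of p "{0..<n}"] by auto
      from minor[OF this] show ?thesis
        by (simp add: split transpose_def mult.commute)
    qed
    ultimately show ?thesis by simp
  qed
  then have "(\<Sum>p\<in>?P. ?t (p \<circ> ?\<tau>)) = - (\<Sum>p\<in>?P. ?t p)"
    by (simp add: sum_negf)
  then have "det A = - det A"
    using sum_permutations_compose_right[OF \<tau>, of ?t] by (simp add: det_def'[OF A])
  then show ?thesis by simp
qed

text \<open>
  Row \<open>i\<close> is the sum over the blocks \<open>b\<close> of its restrictions to the columns in \<open>b\<close>; the formula
  is multilinearity of the determinant, with \<open>\<kappa> i\<close> the block chosen for row \<open>i\<close>. It
  is read off from the Leibniz formula by distributing each product.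
\<close>

lemma det_expand_blocks:
  fixes A :: "'b :: comm_ring_1 mat"
  assumes A: "A \<in> carrier_mat n n" and K: "finite K" "blk \<in> {0..<n} \<rightarrow> K"
  shows "det A =
    (\<Sum>\<kappa>\<in>{0..<n} \<rightarrow>\<^sub>E K. det (mat n n (\<lambda>(i, j). if blk j = \<kappa> i then A $$ (i, j) else 0)))"
    (is "_ = (\<Sum>\<kappa>\<in>_. det (?B \<kappa>))")
proof -
  let ?P = "{p. p permutes {0..<n}}"
  have "(\<Prod>i = 0..<n. A $$ (i, p i)) =
      (\<Sum>\<kappa>\<in>{0..<n} \<rightarrow>\<^sub>E K. \<Prod>i = 0..<n. ?B \<kappa> $$ (i, p i))" if p: "p \<in> ?P" for p
  proof -
    have pi: "p i < n" if "i < n" for i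
      using p that permutes_in_image[of p "{0..<n}"] by auto
    have "(\<Prod>i = 0..<n. A $$ (i, p i)) =
        (\<Prod>i = 0..<n. \<Sum>c\<in>K. if blk (p i) = c then A $$ (i, p i) else 0)"
      using K pi by (intro prod.cong) (auto simp: Pi_iff)
    also have "\<dots> = (\<Sum>\<kappa>\<in>{0..<n} \<rightarrow>\<^sub>E K. \<Prod>i = 0..<n. if blk (p i) = \<kappa> i then A $$ (i, p i) else 0)"
      using K by (intro prod_sum_PiE) auto
    also have "\<dots> = (\<Sum>\<kappa>\<in>{0..<n} \<rightarrow>\<^sub>E K. \<Prod>i = 0..<n. ?B \<kappa> $$ (i, p i))"
      using pi by (intro sum.cong prod.cong) auto
    finally show ?thesis .
  qed
  then have "det A = (\<Sum>p\<in>?P. \<Sum>\<kappa>\<in>{0..<n} \<rightarrow>\<^sub>E K. signof p * (\<Prod>i = 0..<n. ?B \<kappa> $$ (i, p i)))"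
    by (simp add: det_def'[OF A] sum_distrib_left)
  also have "\<dots> = (\<Sum>\<kappa>\<in>{0..<n} \<rightarrow>\<^sub>E K. \<Sum>p\<in>?P. signof p * (\<Prod>i = 0..<n. ?B \<kappa> $$ (i, p i)))"
    by (rule sum.swap)
  also have "\<dots> = (\<Sum>\<kappa>\<in>{0..<n} \<rightarrow>\<^sub>E K. det (?B \<kappa>))"
    by (intro sum.cong det_def'[symmetric]) auto
  finally show ?thesis .
qed

text \<open>
  A nonzero summand of the block expansion of the determinant gives \<open>\<kappa>\<close>. If all 2 by 2 minors
  of the rows \<open>v\<close> and \<open>w\<close> inside their common block vanished, so would all 2 by 2 minors of the
  two restricted rows, which are zero outside this block, and with them the summand.
\<close>

lemma ex_block_assignment:
  fixes M :: "'v \<Rightarrow> 'c \<Rightarrow> int" and N :: "'c \<Rightarrow> 'v \<Rightarrow> int" and blk :: "'c \<Rightarrow> 'k"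
  assumes V: "finite V" and J: "finite J" and card: "card V = card J"
    and K: "finite K" "blk \<in> J \<rightarrow> K"
    and inv: "\<And>c d. c \<in> J \<Longrightarrow> d \<in> J \<Longrightarrow> (\<Sum>v\<in>V. N c v * M v d) = (if c = d then 1 else 0)"
  obtains \<kappa> where "\<kappa> \<in> V \<rightarrow> K"
    "\<forall>v\<in>V. \<forall>w\<in>V. v \<noteq> w \<longrightarrow> \<kappa> v = \<kappa> w \<longrightarrow>
      (\<exists>c\<in>J. \<exists>d\<in>J. blk c = \<kappa> v \<and> blk d = \<kappa> v \<and> M v c * M w d \<noteq> M v d * M w c)"
proof -
  define n where "n = card V"
  obtain r where r: "bij_betw r {0..<n} V"
    using V ex_bij_betw_nat_finite n_def by blast
  obtain s where s: "bij_betw s {0..<n} J"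
    using J card ex_bij_betw_nat_finite n_def by metis
  have rV: "r i \<in> V" and sJ: "s i \<in> J" if "i < n" for i
    using that r s by (auto simp: bij_betw_def)
  define A where "A = mat n n (\<lambda>(i, j). M (r i) (s j))"
  define B where "B = mat n n (\<lambda>(i, j). N (s i) (r j))"
  have AB: "A \<in> carrier_mat n n" "B \<in> carrier_mat n n" by (simp_all add: A_def B_def)
  have "B * A = 1\<^sub>m n"
  proof (rule eq_matI)
    fix i j assume "i < dim_row (1\<^sub>m n :: int mat)" "j < dim_col (1\<^sub>m n :: int mat)"
    then have ij: "i < n" "j < n" by auto
    then have "(B * A) $$ (i, j) = (\<Sum>l = 0..<n. N (s i) (r l) * M (r l) (s j))"
      by (simp add: A_def B_def scalar_prod_def)
    also have "\<dots> = (\<Sum>v\<in>V. N (s i) v * M v (s j))"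
      by (rule sum.reindex_bij_betw[OF r])
    also have "\<dots> = (if s i = s j then 1 else 0)"
      using inv ij sJ by simp
    also have "\<dots> = 1\<^sub>m n $$ (i, j)"
      using ij s by (auto simp: bij_betw_def inj_on_eq_iff)
    finally show "(B * A) $$ (i, j) = 1\<^sub>m n $$ (i, j)" .
  qed (use AB in auto)
  then have "det B * det A = 1"
    using det_mult[OF AB(2,1)] by simp
  then have "det A \<noteq> 0" by auto
  moreover have "blk \<circ> s \<in> {0..<n} \<rightarrow> K" using K sJ by auto
  ultimately have "(\<Sum>\<kappa>\<in>{0..<n} \<rightarrow>\<^sub>E K.
      det (mat n n (\<lambda>(i, j). if (blk \<circ> s) j = \<kappa> i then A $$ (i, j) else 0))) \<noteq> 0"
    using det_expand_blocks[OF AB(1) K(1)] by simp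
  then obtain \<rho> where \<rho>: "\<rho> \<in> {0..<n} \<rightarrow>\<^sub>E K"
    and det: "det (mat n n (\<lambda>(i, j). if (blk \<circ> s) j = \<rho> i then A $$ (i, j) else 0)) \<noteq> 0"
    by (rule sum.not_neutral_contains_not_neutral)
  define \<kappa> where "\<kappa> v = \<rho> (the_inv_into {0..<n} r v)" for v
  have \<kappa>: "\<kappa> (r i) = \<rho> i" if "i < n" for i
    using that r by (simp add: \<kappa>_def bij_betw_def the_inv_into_f_f)
  have row: "\<exists>i<n. r i = v" if "v \<in> V" for v
    using that r by (auto simp: bij_betw_def)
  show thesis
  proof
    show "\<kappa> \<in> V \<rightarrow> K" using row \<kappa> \<rho> by fastforce
  next
    show "\<forall>v\<in>V. \<forall>w\<in>V. v \<noteq> w \<longrightarrow> \<kappa> v = \<kappa> w \<longrightarrow>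
      (\<exists>c\<in>J. \<exists>d\<in>J. blk c = \<kappa> v \<and> blk d = \<kappa> v \<and> M v c * M w d \<noteq> M v d * M w c)"
    proof (intro ballI impI)
      fix v w assume "v \<in> V" "w \<in> V" and vw: "v \<noteq> w" "\<kappa> v = \<kappa> w"
      then obtain i j where ij: "i < n" "r i = v" "j < n" "r j = w" using row by metis
      show "\<exists>c\<in>J. \<exists>d\<in>J. blk c = \<kappa> v \<and> blk d = \<kappa> v \<and> M v c * M w d \<noteq> M v d * M w c"
      proof (rule ccontr)
        assume neg: "\<not> ?thesis"
        let ?D = "mat n n (\<lambda>(i, j). if (blk \<circ> s) j = \<rho> i then A $$ (i, j) else 0)"
        have "det ?D = 0"
        proof (rule det_zero_if_minors_zero[of _ n i j])
          have "\<rho> i = \<kappa> v" "\<rho> j = \<kappa> v" using ij \<kappa> vw by auto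
          then show "?D $$ (i, c) * ?D $$ (j, d) = ?D $$ (i, d) * ?D $$ (j, c)"
            if "c < n" "d < n" for c d
            using that ij neg sJ by (auto simp: A_def)
        qed (use ij vw in auto)
        with det show False by contradiction
      qed
    qed
  qed
qed

section \<open>Products of groups\<close>

definition product_embed :: "'i set \<Rightarrow> ('i \<Rightarrow> ('g, 'b) monoid_scheme) \<Rightarrow> 'i \<Rightarrow> 'g \<Rightarrow> 'i \<Rightarrow> 'g" where
  "product_embed I G i a = (\<lambda>l\<in>I. if l = i then a else \<one>\<^bsub>G l\<^esub>)"

lemma product_embed_hom:
  assumes "\<And>i. i \<in> I \<Longrightarrow> group (G i)" "i \<in> I"
  shows "product_embed I G i \<in> hom (G i) (product_group I G)"
proof (rule homI)
  have [simp]: "\<one>\<^bsub>G l\<^esub> \<in> carrier (G l)" "\<one>\<^bsub>G l\<^esub> \<otimes>\<^bsub>G l\<^esub> \<one>\<^bsub>G l\<^esub> = \<one>\<^bsub>G l\<^esub>" if "l \<in> I" for l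
    using assms(1)[OF that] by (simp_all add: group.is_monoid)
  fix x assume x: "x \<in> carrier (G i)"
  then show "product_embed I G i x \<in> carrier (product_group I G)"
    by (auto simp: product_embed_def)
  fix y assume "y \<in> carrier (G i)"
  show "product_embed I G i (x \<otimes>\<^bsub>G i\<^esub> y) =
      product_embed I G i x \<otimes>\<^bsub>product_group I G\<^esub> product_embed I G i y"
    by (auto simp: product_embed_def)
qed

lemma product_proj_hom:
  "i \<in> I \<Longrightarrow> (\<lambda>x. x i) \<in> hom (product_group I G) (G i)"
  by (auto simp: hom_def)

text \<open>
  An element is the product of its coordinates, each placed in its factor; induction on the set
  \<open>S\<close> of coordinates collected so far.
\<close>

lemma product_group_generated_by_factors:
  assumes G: "\<And>i. i \<in> I \<Longrightarrow> group (G i)" and I: "finite I"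
    and H: "subgroup H (product_group I G)"
    and emb: "\<And>i a. i \<in> I \<Longrightarrow> a \<in> carrier (G i) \<Longrightarrow> product_embed I G i a \<in> H"
  shows "carrier (product_group I G) \<subseteq> H"
proof
  fix x assume x: "x \<in> carrier (product_group I G)"
  have "(\<lambda>l\<in>I. if l \<in> S then x l else \<one>\<^bsub>G l\<^esub>) \<in> H" if "finite S" "S \<subseteq> I" for S
    using that
  proof (induction S)
    case empty
    then show ?case using subgroup.one_closed[OF H] by (simp add: restrict_def)
  next
    case (insert i S)
    have xi: "x l \<in> carrier (G l)" if "l \<in> I" for l using x that by auto
    have "(\<lambda>l\<in>I. if l \<in> insert i S then x l else \<one>\<^bsub>G l\<^esub>) =
        product_embed I G i (x i) \<otimes>\<^bsub>product_group I G\<^esub> (\<lambda>l\<in>I. if l \<in> S then x l else \<one>\<^bsub>G l\<^esub>)"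
      using insert.hyps(2) xi G
      by (auto simp: product_embed_def group.is_monoid monoid.l_one monoid.r_one)
    also have "\<dots> \<in> H"
    proof (rule subgroup.m_closed[OF H])
      show "product_embed I G i (x i) \<in> H" using insert.prems xi emb by blast
      show "(\<lambda>l\<in>I. if l \<in> S then x l else \<one>\<^bsub>G l\<^esub>) \<in> H"
        by (rule insert.IH) (use insert.prems in blast)
    qed
    finally show ?case .
  qed
  moreover have "(\<lambda>l\<in>I. if l \<in> I then x l else \<one>\<^bsub>G l\<^esub>) = x"
    using x by (auto simp: PiE_iff extensional_def)
  ultimately show "x \<in> H" using I by (metis subset_refl)
qed

lemma product_embed_commute:
  assumes G: "\<And>i. i \<in> I \<Longrightarrow> group (G i)"
    and ij: "i \<in> I" "j \<in> I" "i \<noteq> j" and ab: "a \<in> carrier (G i)" "b \<in> carrier (G j)"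
  shows "product_embed I G i a \<otimes>\<^bsub>product_group I G\<^esub> product_embed I G j b =
    product_embed I G j b \<otimes>\<^bsub>product_group I G\<^esub> product_embed I G i a"
  using assms by (auto simp: product_embed_def group.is_monoid monoid.l_one monoid.r_one
      intro!: restrict_ext)

section \<open>Colourings and epimorphisms\<close>

lemma colorable_imp_epi:
  fixes V :: "'a set"
  assumes graph: "finite_simplicial_graph V E" and col: "colorable k V E"
  obtains m :: "nat \<Rightarrow> nat" and h where "(\<Sum>i = 1..k. m i) = card V"
    "h \<in> epi (raag V E) (product_group {1..k} (\<lambda>i. free_group {1..m i}))"
proof -
  obtain \<kappa> where \<kappa>: "\<kappa> ` V \<subseteq> {1..k}" "\<And>v w. {v, w} \<in> E \<Longrightarrow> \<kappa> v \<noteq> \<kappa> w"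
    using col by (auto simp: colorable_def)
  have V: "finite V" using graph by (simp add: finite_simplicial_graph_def)
  define m where "m i = card {v \<in> V. \<kappa> v = i}" for i
  have "\<exists>f. bij_betw f {v \<in> V. \<kappa> v = i} {1..m i}" for i
    by (rule finite_same_card_bij) (use V in \<open>auto simp: m_def\<close>)
  then obtain b where b: "\<And>i. bij_betw (b i) {v \<in> V. \<kappa> v = i} {1..m i}" by metis
  let ?F = "\<lambda>i. free_group {1..m i}"
  let ?P = "product_group {1..k} ?F"
  have F: "group (?F i)" for i by (rule group_free_group)
  have emb: "product_embed {1..k} ?F i \<in> hom (?F i) ?P" if "i \<in> {1..k}" for i
    using that by (intro product_embed_hom group_free_group)
  interpret P: group ?P by (rule product_group[OF F])
  interpret A: group "raag V E" by (rule group_raag[OF graph])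
  define f where "f v = product_embed {1..k} ?F (\<kappa> v) (free_gen {1..m (\<kappa> v)} (b (\<kappa> v) v))" for v
  have gen: "free_gen {1..m (\<kappa> v)} (b (\<kappa> v) v) \<in> carrier (?F (\<kappa> v))" if "v \<in> V" for v
    using that b[of "\<kappa> v"] by (intro free_gen_closed) (auto simp: bij_betw_def)
  have f: "f \<in> V \<rightarrow> carrier ?P"
  proof
    fix v assume v: "v \<in> V"
    then have "\<kappa> v \<in> {1..k}" using \<kappa>(1) by blast
    from hom_in_carrier[OF emb[OF this] gen[OF v]]
    show "f v \<in> carrier ?P" unfolding f_def .
  qed
  have "f v \<otimes>\<^bsub>?P\<^esub> f w = f w \<otimes>\<^bsub>?P\<^esub> f v" if e: "{v, w} \<in> E" for v w
    unfolding f_def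
    by (rule product_embed_commute) (use edge_vertices[OF graph e] \<kappa> e gen F in auto)
  then obtain h where h: "h \<in> hom (raag V E) ?P" "\<And>v. v \<in> V \<Longrightarrow> h (raag_gen V E v) = f v"
    using raag_lift[OF graph P.is_group f] by blast
  interpret h: group_hom "raag V E" ?P h using h by unfold_locales
  have H: "subgroup (h ` carrier (raag V E)) ?P" by (rule h.img_is_subgroup)
  have "product_embed {1..k} ?F i a \<in> h ` carrier (raag V E)"
    if i: "i \<in> {1..k}" and a: "a \<in> carrier (?F i)" for i a
  proof -
    interpret Fi: group "?F i" by (rule F)
    obtain u where u: "u \<in> words {1..m i}" "a = word_eval (?F i) (free_gen {1..m i}) u"
      using a by (rule free_group_elem)
    have "product_embed {1..k} ?F i a =
        word_eval ?P (product_embed {1..k} ?F i \<circ> free_gen {1..m i}) u"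
      unfolding u(2)
      by (rule Fi.hom_word_eval[OF P.is_group emb[OF i] free_gen_in_carrier u(1)])
    moreover have "product_embed {1..k} ?F i (free_gen {1..m i} j) \<in> h ` carrier (raag V E)"
      if "j \<in> {1..m i}" for j
    proof -
      have "j \<in> b i ` {v \<in> V. \<kappa> v = i}" using that b[of i] by (simp add: bij_betw_def)
      then obtain v where v: "v \<in> V" "\<kappa> v = i" "j = b i v" by auto
      then have "product_embed {1..k} ?F i (free_gen {1..m i} j) = h (raag_gen V E v)"
        by (simp add: h(2) f_def)
      then show ?thesis
        using v raag_gen_in_carrier[OF graph] by auto
    qed
    ultimately show ?thesis
      using P.word_eval_in_subgroup[OF H _ u(1)] by (simp add: Pi_iff)
  qed
  then have "carrier ?P \<subseteq> h ` carrier (raag V E)"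
    by (intro product_group_generated_by_factors H F) auto
  then have "h ` carrier (raag V E) = carrier ?P"
    using subgroup.subset[OF H] by blast
  then have "h \<in> epi (raag V E) ?P"
    using h(1) unfolding epi_def by blast
  moreover have "(\<Sum>i = 1..k. m i) = card V"
    unfolding m_def card_eq_sum using sum.group[OF V _ \<kappa>(1), of "\<lambda>_. 1 :: nat"] by simp
  ultimately show thesis by (rule that[rotated])
qed

text \<open>
  In an abelian group only the exponent sum of each letter matters. The exponent sum of \<open>v\<close> in \<open>u\<close>
  is itself the value of \<open>u\<close> at the indicator function of \<open>v\<close>.
\<close>

lemma word_eval_integer_group:
  assumes "finite V" "u \<in> words V"
  shows "word_eval integer_group g u =
    (\<Sum>v\<in>V. word_eval integer_group (\<lambda>x. if x = v then 1 else 0) u * g v)"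
  using assms(2)
proof (induction rule: lists.induct)
  case Nil
  then show ?case by simp
next
  case (Cons a u)
  obtain x b where a: "a = (x, b)" by force
  have x: "x \<in> V" using Cons.hyps a by auto
  have "(\<Sum>v\<in>V. (if x = v then 1 else 0) * g v) = g x"
    using x assms(1) by (simp add: if_distrib[of "\<lambda>t. t * _"] sum.delta cong: if_cong)
  then show ?case
    using Cons.IH by (cases b) (simp_all add: a distrib_right left_diff_distrib sum.distrib sum_subtractf)
qed

lemma epi_imp_colorable:
  fixes V :: "'a set" and m :: "nat \<Rightarrow> nat"
  assumes graph: "finite_simplicial_graph V E" and m: "(\<Sum>i = 1..k. m i) = card V"
    and h: "h \<in> epi (raag V E) (product_group {1..k} (\<lambda>i. free_group {1..m i}))"
  shows "colorable k V E"
proof -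
  have V: "finite V" using graph by (simp add: finite_simplicial_graph_def)
  let ?F = "\<lambda>i. free_group {1..m i}"
  let ?P = "product_group {1..k} ?F"
  have F: "group (?F i)" for i by (rule group_free_group)
  have emb: "product_embed {1..k} ?F i \<in> hom (?F i) ?P" if "i \<in> {1..k}" for i
    using that by (intro product_embed_hom group_free_group)
  interpret P: group ?P by (rule product_group[OF F])
  interpret A: group "raag V E" by (rule group_raag[OF graph])
  have hom: "h \<in> hom (raag V E) ?P" and surj: "h ` carrier (raag V E) = carrier ?P"
    using h by (auto simp: epi_def)
  define J where "J = Sigma {1..k} (\<lambda>i. {1..m i})"
  \<comment> \<open>\<open>\<epsilon> i j\<close> is the exponent sum of the generator \<open>j\<close> on the \<open>i\<close>-th factor.\<close>
  have "\<exists>\<epsilon>. \<epsilon> \<in> hom (?F i) integer_group \<and>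
      (\<forall>l\<in>{1..m i}. \<epsilon> (free_gen {1..m i} l) = (if l = j then 1 else 0))" for i j
    by (rule group.free_group_lift[OF group_integer_group, of "\<lambda>l. if l = j then 1 else 0" "{1..m i}"])
      auto
  then obtain \<epsilon> where \<epsilon>: "\<And>i j. \<epsilon> i j \<in> hom (?F i) integer_group"
    "\<And>i j l. l \<in> {1..m i} \<Longrightarrow> \<epsilon> i j (free_gen {1..m i} l) = (if l = j then 1 else 0)"
    by metis
  define \<phi> where "\<phi> c y = \<epsilon> (fst c) (snd c) (h y (fst c))" for c y
  have \<phi>: "\<phi> c \<in> hom (raag V E) integer_group" if "c \<in> J" for c
  proof -
    have "fst c \<in> {1..k}" using that by (auto simp: J_def)
    from hom_compose[OF hom_compose[OF hom product_proj_hom[OF this]] \<epsilon>(1)]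
    show ?thesis by (simp add: \<phi>_def[abs_def] comp_def)
  qed
  define e where "e c = product_embed {1..k} ?F (fst c) (free_gen {1..m (fst c)} (snd c))" for c
  have "\<exists>u\<in>words V. h (word_eval (raag V E) (raag_gen V E) u) = e c" if "c \<in> J" for c
  proof -
    have c: "fst c \<in> {1..k}" "snd c \<in> {1..m (fst c)}" using that by (auto simp: J_def)
    from hom_in_carrier[OF emb[OF c(1)] free_gen_closed[OF c(2)]]
    have "e c \<in> carrier ?P" unfolding e_def .
    then have "e c \<in> h ` carrier (raag V E)" unfolding surj .
    then obtain y where y: "y \<in> carrier (raag V E)" "e c = h y" by (rule imageE)
    obtain u where "u \<in> words V" "y = word_eval (raag V E) (raag_gen V E) u"
      using y(1) by (rule raag_elem[OF graph])
    then show ?thesis using y(2) by metis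
  qed
  then obtain u where u: "\<And>c. c \<in> J \<Longrightarrow> u c \<in> words V"
    "\<And>c. c \<in> J \<Longrightarrow> h (word_eval (raag V E) (raag_gen V E) (u c)) = e c"
    by metis
  \<comment> \<open>The word \<open>u c\<close> represents a preimage of the free generator \<open>c\<close>. Its exponent sums \<open>N c\<close>
    form row \<open>c\<close> of a left inverse of \<open>M\<close>.\<close>
  define M where "M v c = \<phi> c (raag_gen V E v)" for v c
  define N where "N c v = word_eval integer_group (\<lambda>x. if x = v then 1 else 0) (u c)" for c v
  have inv: "(\<Sum>v\<in>V. N c v * M v d) = (if c = d then 1 else 0)" if cd: "c \<in> J" "d \<in> J" for c d
  proof -
    have "(\<Sum>v\<in>V. N c v * M v d) = word_eval integer_group (\<phi> d \<circ> raag_gen V E) (u c)"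
      unfolding word_eval_integer_group[OF V u(1)[OF cd(1)], of "\<phi> d \<circ> raag_gen V E"]
      by (simp add: M_def N_def)
    also have "\<dots> = \<phi> d (word_eval (raag V E) (raag_gen V E) (u c))"
      using A.hom_word_eval[OF group_integer_group \<phi> raag_gen_in_carrier[OF graph]] u(1) cd by simp
    also have "\<dots> = \<epsilon> (fst d) (snd d) (e c (fst d))"
      by (simp add: \<phi>_def u(2) cd)
    also have "\<dots> = (if c = d then 1 else 0)"
    proof (cases "fst c = fst d")
      case True
      have d: "fst d \<in> {1..k}" and c: "snd c \<in> {1..m (fst d)}"
        using cd True by (auto simp: J_def)
      have "e c (fst d) = free_gen {1..m (fst d)} (snd c)"
        using d True by (simp add: e_def product_embed_def)
      then show ?thesis
        using True by (simp only: \<epsilon>(2)[OF c] prod_eq_iff simp_thms)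
    next
      case False
      then have "e c (fst d) = \<one>\<^bsub>?F (fst d)\<^esub>"
        using cd by (auto simp: e_def product_embed_def J_def)
      then show ?thesis
        using False hom_one[OF \<epsilon>(1) F group_integer_group] by auto
    qed
    finally show ?thesis .
  qed
  have J: "finite J" "card V = card J" "fst \<in> J \<rightarrow> {1..k}"
    unfolding m[symmetric] J_def by auto
  from V J(1,2) finite_atLeastAtMost J(3) inv obtain \<kappa> where \<kappa>: "\<kappa> \<in> V \<rightarrow> {1..k}"
    "\<forall>v\<in>V. \<forall>w\<in>V. v \<noteq> w \<longrightarrow> \<kappa> v = \<kappa> w \<longrightarrow>
      (\<exists>c\<in>J. \<exists>d\<in>J. fst c = \<kappa> v \<and> fst d = \<kappa> v \<and> M v c * M w d \<noteq> M v d * M w c)"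
    by (rule ex_block_assignment)
  have "\<kappa> v \<noteq> \<kappa> w" if edge: "{v, w} \<in> E" for v w
  proof
    assume eq: "\<kappa> v = \<kappa> w"
    have vw: "v \<in> V" "w \<in> V" "v \<noteq> w" using edge_vertices[OF graph edge] by auto
    let ?i = "\<kappa> v"
    have i: "?i \<in> {1..k}" using \<kappa>(1) vw by auto
    let ?p = "\<lambda>y. h y ?i"
    have p: "?p \<in> hom (raag V E) (?F ?i)"
      using hom_compose[OF hom product_proj_hom[OF i]] by (simp add: comp_def)
    have g: "raag_gen V E v \<in> carrier (raag V E)" "raag_gen V E w \<in> carrier (raag V E)"
      using raag_gen_in_carrier[OF graph] vw by auto
    have "?p (raag_gen V E v) \<otimes>\<^bsub>?F ?i\<^esub> ?p (raag_gen V E w) =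
        ?p (raag_gen V E w) \<otimes>\<^bsub>?F ?i\<^esub> ?p (raag_gen V E v)"
      using hom_mult[OF p] g raag_gen_commute[OF graph edge] by metis
    from free_group_commuting_minor_zero[OF hom_in_carrier[OF p g(1)] hom_in_carrier[OF p g(2)] this \<epsilon>(1) \<epsilon>(1)]
    have "M v c * M w d = M v d * M w c" if "fst c = ?i" "fst d = ?i" for c d
      using that by (simp add: M_def \<phi>_def)
    then show False using \<kappa>(2) vw eq by blast
  qed
  then show ?thesis
    using \<kappa>(1) by (auto simp: colorable_def intro!: exI[of _ \<kappa>])
qed

theorem theorem1p2:
  fixes V :: "'a set" and E :: "'a set set" and n k :: nat
  assumes "finite_simplicial_graph V E" and "card V = n" and "k \<ge> 1"
  shows "colorable k V E \<longleftrightarrow>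
    (\<exists>m :: nat \<Rightarrow> nat. (\<Sum>i = 1..k. m i) = n \<and>
      (\<exists>h. h \<in> epi (raag V E) (product_group {1..k} (\<lambda>i. free_group {1..m i}))))"
proof
  assume "colorable k V E"
  with assms(1) show "\<exists>m :: nat \<Rightarrow> nat. (\<Sum>i = 1..k. m i) = n \<and>
      (\<exists>h. h \<in> epi (raag V E) (product_group {1..k} (\<lambda>i. free_group {1..m i})))"
    unfolding assms(2)[symmetric] by (rule colorable_imp_epi) blast
next
  assume "\<exists>m :: nat \<Rightarrow> nat. (\<Sum>i = 1..k. m i) = n \<and>
      (\<exists>h. h \<in> epi (raag V E) (product_group {1..k} (\<lambda>i. free_group {1..m i})))"
  then show "colorable k V E"
    unfolding assms(2)[symmetric] using epi_imp_colorable[OF assms(1)] by blast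
qed

end
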